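(* Let $a_1,\dots,a_n>0$ and let $T(z_1,\dots,z_n)=\sum_{i=1}^nT_i(z_i)$, where each $T_i:[0,\infty)\to\mathbb{R}$ is concave and non-positive. Let $C_{SA}$ be the optimal value of $$\max_{\hat p}\ T(\hat p(a_1),\dots,\hat p(a_n))$$ over all functions $\hat p:[0,\infty)\to\mathbb{R}$ with $\hat p(x+y)\le\hat p(x)+\hat p(y)$ for all $x,y\ge0$, $\hat p(y)\ge\hat p(x)$ for all $y\ge x\ge0$, and $\hat p(x)\ge0$ for all $x\ge0$. Let $C_{MBP}$ be the optimal value of $$\max_{\mathbf z\in\mathbb{R}^n}\ T(z_1,\dots,z_n)$$ subject to $z_j/a_j\le z_i/a_i$ and $z_j\ge z_i$ for all $i,j$ with $a_j\ge a_i$, and $z_j\ge0$ for all $1\le j\le n$. Then $$C_{SA}+\sum_{i=1}^nT_i(0)/2\le C_{MBP}\le C_{SA}.$$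
   Context: The optimal value is the supremum of the objective over the feasible set. *)

theory Defs
  imports "HOL-Analysis.Analysis"
begin

text \<open>
  Functions with domain \<open>[0, \<infinity>)\<close> are represented by total functions on \<open>real\<close>; all
  conditions and evaluations involve arguments in \<open>[0, \<infinity>)\<close> only.
\<close>

definition separable_objective :: "('n::finite \<Rightarrow> real \<Rightarrow> real) \<Rightarrow> real ^ 'n \<Rightarrow> real" where
  "separable_objective T z = (\<Sum>i\<in>UNIV. T i (z $ i))"

definition SA_feasible :: "(real \<Rightarrow> real) \<Rightarrow> bool" where
  "SA_feasible p \<longleftrightarrow>
     (\<forall>x\<ge>0. \<forall>y\<ge>0. p (x + y) \<le> p x + p y) \<and>
     (\<forall>x\<ge>0. \<forall>y\<ge>x. p y \<ge> p x) \<and>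
     (\<forall>x\<ge>0. p x \<ge> 0)"

definition MBP_feasible :: "real ^ 'n::finite \<Rightarrow> real ^ 'n \<Rightarrow> bool" where
  "MBP_feasible a z \<longleftrightarrow>
     (\<forall>i j. a $ j \<ge> a $ i \<longrightarrow> z $ j / a $ j \<le> z $ i / a $ i \<and> z $ j \<ge> z $ i) \<and>
     (\<forall>j. z $ j \<ge> 0)"

text \<open>
  Optimal values are suprema in the complete lattice \<open>ereal\<close>, so that they need no
  side condition of non-emptiness or boundedness.
\<close>

definition C_SA :: "real ^ 'n::finite \<Rightarrow> ('n \<Rightarrow> real \<Rightarrow> real) \<Rightarrow> ereal" where
  "C_SA a T = (SUP p\<in>{p. SA_feasible p}. ereal (separable_objective T (\<chi> i. p (a $ i))))"

definition C_MBP :: "real ^ 'n::finite \<Rightarrow> ('n \<Rightarrow> real \<Rightarrow> real) \<Rightarrow> ereal" where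
  "C_MBP a T = (SUP z\<in>{z. MBP_feasible a z}. ereal (separable_objective T z))"

end

theory Submission
  imports Defs
begin

text \<open>
  Both inequalities rest on the envelope \<open>e(x) = min\<^sub>i w\<^sub>i max(1, x / a\<^sub>i)\<close> of nonnegative
  data \<open>w\<close>. It is nondecreasing and \<open>e(x) / x\<close> is nonincreasing, so it is subadditive and its values
  at the \<open>a\<^sub>i\<close> satisfy the MBP constraints. If \<open>w\<close> is MBP feasible, then \<open>e(a\<^sub>i) = w\<^sub>i\<close>.
  If \<open>w\<^sub>i = p(a\<^sub>i)\<close> for a subadditive nondecreasing \<open>p\<close>, then \<open>p(x) \<le> \<lceil>x / y\<rceil> p(y)\<close> and
  \<open>\<lceil>t\<rceil> \<le> 2 max(1, t)\<close> give \<open>w\<^sub>i / 2 \<le> e(a\<^sub>i) \<le> w\<^sub>i\<close>, and concavity bounds the loss of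
  each \<open>T\<^sub>i\<close> by \<open>-T\<^sub>i(0) / 2\<close>.
\<close>

definition envelope :: "real ^ 'n::finite \<Rightarrow> ('n \<Rightarrow> real) \<Rightarrow> real \<Rightarrow> real" where
  "envelope a w x = (MIN i. w i * max 1 (x / a $ i))"

lemma envelope_le: "envelope a w x \<le> w i * max 1 (x / a $ i)"
  unfolding envelope_def by (rule Min_le) auto

lemma envelope_geI:
  assumes "\<And>i. c \<le> w i * max 1 (x / a $ i)"
  shows "c \<le> envelope a w x"
  unfolding envelope_def using assms by (subst Min_ge_iff) auto

lemma envelope_attained: "\<exists>i. envelope a w x = w i * max 1 (x / a $ i)"
proof -
  have "envelope a w x \<in> range (\<lambda>i. w i * max 1 (x / a $ i))"
    unfolding envelope_def by (rule Min_in) auto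
  then show ?thesis by auto
qed

context
  fixes a :: "real ^ 'n::finite" and w :: "'n \<Rightarrow> real"
  assumes a_pos: "\<And>i. a $ i > 0" and w_nonneg: "\<And>i. w i \<ge> 0"
begin

lemma envelope_nonneg: "0 \<le> envelope a w x"
  by (rule envelope_geI) (use w_nonneg in \<open>simp add: max_def\<close>)

lemma envelope_mono:
  assumes "x \<le> y"
  shows "envelope a w x \<le> envelope a w y"
proof (rule envelope_geI)
  fix i
  have "x / a $ i \<le> y / a $ i"
    using assms a_pos[of i] by (simp add: divide_right_mono)
  then have "w i * max 1 (x / a $ i) \<le> w i * max 1 (y / a $ i)"
    by (intro mult_left_mono w_nonneg) auto
  then show "envelope a w x \<le> w i * max 1 (y / a $ i)"
    using envelope_le[of a w x i] by linarith
qed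

text \<open>Each quotient \<open>max 1 (x / a $ i) / x\<close> is the maximum of
  \<open>1 / x\<close> and the constant \<open>1 / a $ i\<close>, hence nonincreasing, and a minimum
  of such functions inherits this. The cross-multiplied form also covers
  \<open>x = 0\<close>.\<close>

lemma envelope_ratio_antimono:
  assumes "0 \<le> x" "x \<le> y"
  shows "x * envelope a w y \<le> y * envelope a w x"
proof -
  obtain i where i: "envelope a w x = w i * max 1 (x / a $ i)"
    using envelope_attained by blast
  \<comment> \<open>Once the factor is moved inside the maximum, the second entry is symmetric in
    \<open>x\<close> and \<open>y\<close>, so only the first entry changes.\<close>
  have "x * max 1 (y / a $ i) = max x (x * y / a $ i)"
    using assms by (simp add: max_mult_distrib_left)
  also have "\<dots> \<le> max y (y * x / a $ i)"
    using assms by (simp add: mult.commute max.coboundedI1)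
  also have "\<dots> = y * max 1 (x / a $ i)"
    using assms by (simp add: max_mult_distrib_left)
  finally have "w i * (x * max 1 (y / a $ i)) \<le> w i * (y * max 1 (x / a $ i))"
    by (intro mult_left_mono w_nonneg)
  moreover have "x * envelope a w y \<le> x * (w i * max 1 (y / a $ i))"
    by (intro mult_left_mono envelope_le assms)
  ultimately show ?thesis unfolding i by (simp add: mult_ac)
qed

text \<open>The ratio bound gives each summand on the right at least its proportional share,
  \<open>x / (x + y)\<close> or \<open>y / (x + y)\<close>, of the envelope at \<open>x + y\<close>.
  At \<open>x + y = 0\<close> there is nothing to cancel, and nonnegativity suffices.\<close>

lemma envelope_subadditive:
  assumes "0 \<le> x" "0 \<le> y"
  shows "envelope a w (x + y) \<le> envelope a w x + envelope a w y"
proof (cases "x + y = 0")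
  case True
  then have "x = 0" "y = 0" using assms by auto
  then show ?thesis using envelope_nonneg[of 0] by simp
next
  case False
  then have pos: "0 < x + y" using assms by linarith
  have "x * envelope a w (x + y) \<le> (x + y) * envelope a w x"
    "y * envelope a w (x + y) \<le> (x + y) * envelope a w y"
    using assms by (auto intro: envelope_ratio_antimono)
  then have "(x + y) * envelope a w (x + y) \<le> (x + y) * (envelope a w x + envelope a w y)"
    by (simp add: algebra_simps)
  then show ?thesis using pos by simp
qed

lemma SA_feasible_envelope: "SA_feasible (envelope a w)"
  unfolding SA_feasible_def
  using envelope_subadditive envelope_mono envelope_nonneg by blast

lemma MBP_feasible_envelope: "MBP_feasible a (\<chi> i. envelope a w (a $ i))"
  unfolding MBP_feasible_def
proof (intro conjI allI impI)
  fix i j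
  assume le: "a $ i \<le> a $ j"
  have "a $ i * envelope a w (a $ j) \<le> a $ j * envelope a w (a $ i)"
    using le a_pos[of i] by (intro envelope_ratio_antimono) auto
  then show "(\<chi> i. envelope a w (a $ i)) $ j / a $ j \<le> (\<chi> i. envelope a w (a $ i)) $ i / a $ i"
    using a_pos[of i] a_pos[of j] by (simp add: field_simps)
  show "(\<chi> i. envelope a w (a $ i)) $ i \<le> (\<chi> i. envelope a w (a $ i)) $ j"
    using envelope_mono[OF le] by simp
next
  fix j
  show "0 \<le> (\<chi> i. envelope a w (a $ i)) $ j"
    using envelope_nonneg by simp
qed

lemma envelope_at_node_le: "envelope a w (a $ j) \<le> w j"
  using envelope_le[of a w "a $ j" j] a_pos[of j] by simp

end

text \<open>The MBP constraints say precisely that no competitor in the minimum undercuts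
  \<open>z $ j\<close>: the ratio constraint handles \<open>a $ i \<le> a $ j\<close>, monotonicity
  the opposite order.\<close>

lemma envelope_at_node_eq:
  assumes a_pos: "\<And>i. a $ i > 0" and z: "MBP_feasible a z"
  shows "envelope a (($) z) (a $ j) = z $ j"
proof (rule antisym)
  have z_nonneg: "\<And>i. 0 \<le> z $ i" using z by (simp add: MBP_feasible_def)
  show "envelope a (($) z) (a $ j) \<le> z $ j"
    by (rule envelope_at_node_le[OF a_pos z_nonneg])
  show "z $ j \<le> envelope a (($) z) (a $ j)"
  proof (rule envelope_geI)
    fix i
    show "z $ j \<le> z $ i * max 1 (a $ j / a $ i)"
    proof (cases "a $ i \<le> a $ j")
      case True
      then have "z $ j / a $ j \<le> z $ i / a $ i" using z by (simp add: MBP_feasible_def)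
      then have "z $ j \<le> z $ i * (a $ j / a $ i)"
        using a_pos[of j] by (simp add: field_simps)
      also have "\<dots> \<le> z $ i * max 1 (a $ j / a $ i)"
        by (intro mult_left_mono z_nonneg) auto
      finally show ?thesis .
    next
      case False
      then have "z $ j \<le> z $ i * 1" using z by (simp add: MBP_feasible_def)
      also have "\<dots> \<le> z $ i * max 1 (a $ j / a $ i)"
        by (intro mult_left_mono z_nonneg) auto
      finally show ?thesis .
    qed
  qed
qed

text \<open>The multiplier starts at 1 because multiplier 0 would demand \<open>p 0 \<le> 0\<close>,
  which fails for positive constants \<open>p\<close>.\<close>

lemma SA_feasible_mult_le:
  assumes p: "SA_feasible p" and y: "0 \<le> y"
  shows "p (real (Suc n) * y) \<le> real (Suc n) * p y"
proof (induction n)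
  case (Suc n)
  have "p (real (Suc n) * y + y) \<le> p (real (Suc n) * y) + p y"
    using p y by (simp add: SA_feasible_def)
  then show ?case using Suc by (simp add: algebra_simps)
qed simp

lemma SA_feasible_le_twice_max:
  assumes p: "SA_feasible p" and x: "0 < x" and y: "0 < y"
  shows "p x \<le> 2 * (p y * max 1 (x / y))"
proof -
  define n where "n = nat \<lceil>x / y\<rceil> - 1"
  have "0 < x / y" using x y by simp
  then have Suc_n: "real (Suc n) = of_int \<lceil>x / y\<rceil>"
    unfolding n_def by (simp add: of_nat_diff Suc_diff_1 nat_0_iff)
  have p_y: "0 \<le> p y" using p y by (simp add: SA_feasible_def)
  have "x / y \<le> real (Suc n)" unfolding Suc_n by simp
  then have "x \<le> real (Suc n) * y" using y by (simp only: pos_divide_le_eq)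
  then have "p x \<le> p (real (Suc n) * y)"
    using p x unfolding SA_feasible_def by (meson less_imp_le)
  also have "\<dots> \<le> real (Suc n) * p y"
    using p y by (intro SA_feasible_mult_le) auto
  \<comment> \<open>A ceiling satisfies \<lceil>t\<rceil> < t + 1, and both t and 1 are at most
    max(1, t).\<close>
  also have "\<dots> \<le> (2 * max 1 (x / y)) * p y"
    unfolding Suc_n using p_y by (intro mult_right_mono) linarith+
  finally show ?thesis by (simp add: mult_ac)
qed

text \<open>For \<open>u > 0\<close>, \<open>v\<close> is a convex combination of 0 and
  \<open>u\<close> with weight at least 1/2 on \<open>u\<close>. As \<open>f 0\<close> and
  \<open>f u\<close> are nonpositive, raising their weights to 1/2 and 1 only lowers the concavity
  bound.\<close>

lemma concave_nonpos_half_shrink: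
  fixes f :: "real \<Rightarrow> real"
  assumes f: "concave_on {0..} f" and nonpos: "\<And>x. 0 \<le> x \<Longrightarrow> f x \<le> 0"
    and u: "0 \<le> u" and v: "u / 2 \<le> v" "v \<le> u"
  shows "f u + f 0 / 2 \<le> f v"
proof (cases "u = 0")
  case True
  then show ?thesis using v nonpos[of 0] by simp
next
  case False
  then have u_pos: "0 < u" using u by simp
  define t where "t = v / u"
  have t: "1 / 2 \<le> t" "t \<le> 1" unfolding t_def using u_pos v by (auto simp: field_simps)
  have "(1 - t) * f 0 + t * f u \<le> f ((1 - t) *\<^sub>R 0 + t *\<^sub>R u)"
    using f t u by (intro concave_onD) auto
  also have "(1 - t) *\<^sub>R 0 + t *\<^sub>R u = v" unfolding t_def using u_pos by simp
  finally have "(1 - t) * f 0 + t * f u \<le> f v" .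
  moreover have "(1 / 2) * f 0 \<le> (1 - t) * f 0"
    using t nonpos[of 0] by (intro mult_right_mono_neg) auto
  moreover have "1 * f u \<le> t * f u"
    using t nonpos[OF u] by (intro mult_right_mono_neg) auto
  ultimately show ?thesis by linarith
qed

theorem proposition2:
  fixes a :: "real ^ 'n::finite" and T :: "'n \<Rightarrow> real \<Rightarrow> real"
  assumes a_pos: "\<And>i. a $ i > 0"
    and T_concave: "\<And>i. concave_on {0..} (T i)"
    and T_nonpos: "\<And>i x. x \<ge> 0 \<Longrightarrow> T i x \<le> 0"
  shows "C_SA a T + ereal (\<Sum>i\<in>UNIV. T i 0 / 2) \<le> C_MBP a T \<and> C_MBP a T \<le> C_SA a T"
proof
  define s where "s = (\<Sum>i\<in>UNIV. T i 0 / 2)"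
  \<comment> \<open>The finite constant \<open>s\<close> is moved to the right so that the left side
    is a bare supremum, which can be bounded one feasible \<open>p\<close> at a time.\<close>
  have "C_SA a T \<le> C_MBP a T - ereal s"
    unfolding C_SA_def
  proof (rule SUP_least, clarify)
    fix p
    assume p: "SA_feasible p"
    define w where "w = (\<lambda>i. p (a $ i))"
    define z where "z = (\<chi> i. envelope a w (a $ i))"
    have w_nonneg: "0 \<le> w i" for i
      unfolding w_def using p a_pos[of i] by (simp add: SA_feasible_def)
    have lower: "w i / 2 \<le> z $ i" for i
    proof -
      have "w i / 2 \<le> w j * max 1 (a $ i / a $ j)" for j
        using SA_feasible_le_twice_max[OF p a_pos[of i] a_pos[of j]] unfolding w_def by linarith
      then have "w i / 2 \<le> envelope a w (a $ i)" by (rule envelope_geI)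
      then show ?thesis unfolding z_def by simp
    qed
    have upper: "z $ i \<le> w i" for i
      unfolding z_def using envelope_at_node_le[OF a_pos w_nonneg] by simp
    have "separable_objective T (\<chi> i. p (a $ i)) + s = (\<Sum>i\<in>UNIV. T i (w i) + T i 0 / 2)"
      unfolding separable_objective_def s_def w_def by (simp add: sum.distrib)
    also have "\<dots> \<le> separable_objective T z"
      unfolding separable_objective_def
      by (intro sum_mono concave_nonpos_half_shrink T_concave T_nonpos w_nonneg lower upper)
    finally have "ereal (separable_objective T (\<chi> i. p (a $ i)) + s) \<le> ereal (separable_objective T z)"
      by simp
    also have "\<dots> \<le> C_MBP a T"
      unfolding C_MBP_def z_def using MBP_feasible_envelope[OF a_pos w_nonneg]
      by (intro SUP_upper) simp
    finally show "ereal (separable_objective T (\<chi> i. p (a $ i))) \<le> C_MBP a T - ereal s"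
      by (simp add: ereal_le_minus)
  qed
  then show "C_SA a T + ereal (\<Sum>i\<in>UNIV. T i 0 / 2) \<le> C_MBP a T"
    unfolding s_def by (simp add: ereal_le_minus)
  show "C_MBP a T \<le> C_SA a T"
    unfolding C_MBP_def
  proof (rule SUP_least, clarify)
    fix z
    assume z: "MBP_feasible a z"
    \<comment> \<open>The envelope extends \<open>z\<close> to a function on the half-line with the
      same values at the nodes, so the objective does not change.\<close>
    then have "SA_feasible (envelope a (($) z))"
      by (intro SA_feasible_envelope a_pos) (simp add: MBP_feasible_def)
    then have "ereal (separable_objective T (\<chi> i. envelope a (($) z) (a $ i))) \<le> C_SA a T"
      unfolding C_SA_def by (intro SUP_upper) simp
    then show "ereal (separable_objective T z) \<le> C_SA a T"
      by (simp add: envelope_at_node_eq[OF a_pos z])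
  qed
qed

end
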